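(* Let $(V,\|\cdot\|_V)$ be a separable $\mathbb{R}$-Banach space, let $(W,\|\cdot\|_W)$ be an $\mathbb{R}$-Banach space, let $T\in(0,\infty)$, $F\in C(V,W)$, $o\in C([0,T],V)$, let $S\colon(0,T)\to L(W,V)$ be a $\mathcal{B}((0,T))/\mathcal{B}(L(W,V))$-measurable function, let $\mathcal{S}\colon[0,T]\to L(V)$ be a $\mathcal{B}([0,T])/\mathcal{B}(L(V))$-measurable function, let $\phi\colon(0,T)\to(0,\infty)$ be a function, and assume for all $r\in[0,\infty)$, $t_1\in[0,T)$, $t_2\in(0,T-t_1)$, $v\in V$ that $([0,T]\ni t\mapsto\mathcal{S}_t v\in V)\in C([0,T],V)$, $S_{t_1+t_2}=\mathcal{S}_{t_1}S_{t_2}$, $$\sup\Big(\Big\{\tfrac{\|F(v)-F(w)\|_W}{\|v-w\|_V}\colon v,w\in V,\ v\neq w,\ \|v\|_V+\|w\|_V\le r\Big\}\cup\{0\}\Big)+\inf_{\alpha\in(0,1)}\ \sup_{s\in(0,T),\,t\in(s,T)}\Big[s^{\alpha}\big(\|S_s\|_{L(W,V)}+\|S_t-S_s\|_{L(W,V)}\,|\phi(t-s)|^{-1}\big)\Big]<\infty,$$ and $\limsup_{t\searrow0}\phi(t)=0$. Then there exists a unique convex set $J\subseteq[0,T]$ with $\{0\}\subsetneq J$ such that (i) there exists a unique $x\in C(J,V)$ which satisfies for all $t\in J$ that $$\int_0^t\|S_{t-s}F(x_s)\|_V\,ds<\limsup_{s\nearrow\sup(J)}\Big[\frac{1}{T-s}+\|x_s\|_V\Big]=\infty$$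 and $x_t=\int_0^t S_{t-s}F(x_s)\,ds+o_t$, (ii) for all convex sets $I\subseteq[0,T]$ and all $y\in C(I,V)$ with $I\supseteq J$, $\forall\,t\in I\colon\int_0^t\|S_{t-s}F(y_s)\|_V\,ds<\infty$, and $\forall\,t\in I\colon y_t=\int_0^t S_{t-s}F(y_s)\,ds+o_t$ it holds that $x=y$, where $x$ is the function from (i), and (iii) for all $y\in C(J,V)$ with $\forall\,t\in J\colon\int_0^t\|S_{t-s}F(y_s)\|_V\,ds<\infty$, $\forall\,t\in J\colon y_t=\int_0^t S_{t-s}F(y_s)\,ds+o_t$, and $\limsup_{s\nearrow\sup(J)}\|y_s\|_V<\infty$ it holds that $J=[0,T]$.
   Context: $C(X,Y)$ is the set of continuous functions from $X$ to $Y$. $L(W,V)$ is the Banach space of bounded linear operators from $W$ to $V$ with the operator norm, and $L(V)=L(V,V)$. $\mathcal{B}(X)$ is the Borel $\sigma$-algebra of $X$ (for $L(W,V)$ and $L(V)$: with respect to the operator norm topology). $V$-valued integrals are Bochner integrals. For functions of time, $x_t$ means $x(t)$, $S_t=S(t)$, $\mathcal{S}_t=\mathcal{S}(t)$, $o_t=o(t)$. The notation $\limsup_{s\nearrow\sup(J)}$ is the left-sided limit superior over $s\in J$, $s<\sup(J)$. Equality $x=y$ in (ii) is equality of functions (including equality of domains, so in particular $I=J$). *)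

theory Defs
  imports "HOL-Analysis.Analysis"
begin

text \<open>
  Functions with domain \<open>X\<close> are represented by total functions that are \<open>undefined\<close> outside
  \<open>X\<close> (\<open>extensional\<close>), so that equality of two members of \<open>C_on X\<close> is equality on \<open>X\<close>.
\<close>

definition C_on :: "'a::topological_space set \<Rightarrow> ('a \<Rightarrow> 'b::topological_space) set" where
  "C_on X = {x \<in> extensional X. continuous_on X x}"

text \<open>
  The integrals from \<open>0\<close> to \<open>t\<close> below are taken over the open interval, because the kernel
  \<open>S\<close> is only meaningful on the open interval from \<open>0\<close> to \<open>T\<close>: its argument \<open>t - s\<close> could
  otherwise be \<open>0\<close> or \<open>T\<close>.
\<close>

definition conv_norm ::
  "(real \<Rightarrow> 'w::real_normed_vector \<Rightarrow>\<^sub>L 'v::real_normed_vector) \<Rightarrow> ('v \<Rightarrow> 'w) \<Rightarrow> (real \<Rightarrow> 'v) \<Rightarrow> real \<Rightarrow> ennreal"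
  where
  "conv_norm S F x t =
     (\<integral>\<^sup>+ s \<in> {0<..<t}. ennreal (norm (blinfun_apply (S (t - s)) (F (x s)))) \<partial>lborel)"

definition conv ::
  "(real \<Rightarrow> 'w::real_normed_vector \<Rightarrow>\<^sub>L 'v::{banach, second_countable_topology})
     \<Rightarrow> ('v \<Rightarrow> 'w) \<Rightarrow> (real \<Rightarrow> 'v) \<Rightarrow> real \<Rightarrow> 'v"
  where
  "conv S F x t = (LINT s:{0<..<t}|lborel. blinfun_apply (S (t - s)) (F (x s)))"

definition mild_solution ::
  "(real \<Rightarrow> 'w::real_normed_vector \<Rightarrow>\<^sub>L 'v::{banach, second_countable_topology})
     \<Rightarrow> ('v \<Rightarrow> 'w) \<Rightarrow> (real \<Rightarrow> 'v) \<Rightarrow> real set \<Rightarrow> (real \<Rightarrow> 'v) \<Rightarrow> bool"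
  where
  "mild_solution S F ob J x \<longleftrightarrow>
     x \<in> C_on J \<and>
     (\<forall>t\<in>J. conv_norm S F x t < \<infinity>) \<and>
     (\<forall>t\<in>J. x t = conv S F x t + ob t)"

definition left_Limsup :: "real set \<Rightarrow> (real \<Rightarrow> ennreal) \<Rightarrow> ennreal" where
  "left_Limsup J f = Limsup (at (Sup J) within {s \<in> J. s < Sup J}) f"

text \<open>
  Maximality is not required here as such; it is expressed by the condition on the left limit
  superior at \<open>Sup J\<close>, in which \<open>1 / (T - s)\<close> makes \<open>Sup J = T\<close> always admissible. For
  \<open>J\<close> contained in \<open>{0..T}\<close> its argument is nonnegative, so that \<open>ennreal\<close> truncates nothing.
\<close>

definition maximal_mild_solution ::
  "real \<Rightarrow> (real \<Rightarrow> 'w::real_normed_vector \<Rightarrow>\<^sub>L 'v::{banach, second_countable_topology})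
     \<Rightarrow> ('v \<Rightarrow> 'w) \<Rightarrow> (real \<Rightarrow> 'v) \<Rightarrow> real set \<Rightarrow> (real \<Rightarrow> 'v) \<Rightarrow> bool"
  where
  "maximal_mild_solution T S F ob J x \<longleftrightarrow>
     x \<in> C_on J \<and>
     (\<forall>t\<in>J.
        conv_norm S F x t < left_Limsup J (\<lambda>s. ennreal (1 / (T - s) + norm (x s))) \<and>
        left_Limsup J (\<lambda>s. ennreal (1 / (T - s) + norm (x s))) = \<infinity> \<and>
        x t = conv S F x t + ob t)"

end

theory Submission
  imports Defs
begin

text \<open>
  The bound on \<open>S\<close> makes it an integrable singular kernel, and the modulus of continuity \<open>\<phi>\<close>
  only serves to make \<open>S\<close> continuous. For a globally Lipschitz nonlinearity the mild equation on
  \<open>{0..T}\<close> is a contraction in a supremum norm with weight \<open>exp (- l * t)\<close>, \<open>l\<close> large; the same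
  weight gives uniqueness for locally Lipschitz nonlinearities. Composing \<open>F\<close> with the radial
  truncation at radius \<open>R\<close> therefore yields one function on all of \<open>{0..T}\<close> that contains every
  solution bounded by \<open>R\<close>. As this function is continuous, a solution on \<open>{0..b}\<close> with \<open>b < T\<close>
  extends beyond \<open>b\<close>, and a bounded solution on \<open>{0..<c}\<close> extends to \<open>c\<close>. The set of all \<open>b\<close> such
  that there is a solution on \<open>{0..b}\<close> is the required interval.
\<close>

section \<open>Integrability of powers and reflection of the convolution integral\<close>

lemma set_integrable_powr:
  fixes a T :: real
  assumes "-1 < a" "0 \<le> T"
  shows "set_integrable lborel {0<..<T} (\<lambda>u. u powr a)"
proof -
  have "(\<lambda>u. u powr a) absolutely_integrable_on {0..T}"
    by (intro nonnegative_absolutely_integrable_1 integrable_on_powr_from_0 assms) auto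
  \<comment> \<open>\<open>absolutely_integrable_on\<close> refers to the completed measure; the
    power is Borel measurable, so integrability passes to \<open>lborel\<close>.\<close>
  then have "set_integrable lborel {0..T} (\<lambda>u. u powr a)"
    unfolding set_integrable_def by (subst (asm) integrable_completion) auto
  then show ?thesis
    by (rule set_integrable_subset) auto
qed

lemma continuous_on_compact_norm_bound:
  fixes f :: "'a::topological_space \<Rightarrow> 'b::real_normed_vector"
  assumes "continuous_on A f" "compact A"
  obtains M where "0 < M" "\<And>x. x \<in> A \<Longrightarrow> norm (f x) \<le> M"
  using compact_imp_bounded[OF compact_continuous_image[OF assms]]
  unfolding bounded_pos by blast

text \<open>The substitution \<open>u = t - s\<close> pins the singularity of the kernel at
  \<open>u = 0\<close> for every \<open>t\<close>, which prepares dominated convergence in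
  \<open>t\<close>. A forcing \<open>h\<close> in place of \<open>F\<close> and \<open>x\<close>
  lets a difference of two convolutions be a convolution again.\<close>

definition duhamel ::
  "(real \<Rightarrow> 'w::real_normed_vector \<Rightarrow>\<^sub>L 'v::{banach, second_countable_topology})
     \<Rightarrow> (real \<Rightarrow> 'w) \<Rightarrow> real \<Rightarrow> 'v"
  where
  "duhamel S h t = (LINT u:{0<..<t}|lborel. blinfun_apply (S u) (h (t - u)))"

lemma conv_eq_duhamel: "conv S F x t = duhamel S (\<lambda>s. F (x s)) t"
  unfolding conv_def duhamel_def set_lebesgue_integral_def
  by (subst lborel_integral_real_affine[of "-1" _ t])
    (auto intro!: Bochner_Integration.integral_cong simp: indicator_def)

lemma duhamel_cong:
  assumes "\<And>s. s \<in> {0<..<t} \<Longrightarrow> h s = k s"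
  shows "duhamel S h t = duhamel S k t"
  unfolding duhamel_def
  by (intro set_lebesgue_integral_cong) (auto simp: assms)

lemma conv_cong:
  assumes "\<And>s. s \<in> {0<..<t} \<Longrightarrow> F (x s) = G (y s)"
  shows "conv S F x t = conv S G y t"
  unfolding conv_eq_duhamel by (intro duhamel_cong assms)

lemma conv_norm_cong:
  assumes "\<And>s. s \<in> {0<..<t} \<Longrightarrow> F (x s) = G (y s)"
  shows "conv_norm S F x t = conv_norm S G y t"
  unfolding conv_norm_def
  by (intro nn_integral_cong) (auto simp: assms indicator_def)

section \<open>Convolution with a weakly singular kernel\<close>

text \<open>Continuity makes the integrands measurable; an exponent above -1 makes them integrable
  near 0.\<close>

locale singular_kernel =
  fixes S :: "real \<Rightarrow> 'w::real_normed_vector \<Rightarrow>\<^sub>L 'v::{banach, second_countable_topology}"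
    and C \<alpha> T :: real
  assumes T_pos: "0 < T"
    and C_nonneg: "0 \<le> C"
    and alpha: "0 < \<alpha>" "\<alpha> < 1"
    and kernel_continuous: "continuous_on {0<..<T} S"
    and kernel_bound: "\<And>u. u \<in> {0<..<T} \<Longrightarrow> norm (S u) \<le> C * u powr - \<alpha>"
begin

text \<open>The Laplace transform at \<open>l\<close> of the kernel majorant, cut off at
  \<open>T\<close>. For \<open>l \<ge> 0\<close> it bounds the convolution operator in the supremum
  norm with weight \<open>exp (- l * t)\<close>.\<close>

definition kernel_weight :: "real \<Rightarrow> real" where
  "kernel_weight l = (LINT u:{0<..<T}|lborel. C * u powr - \<alpha> * exp (- l * u))"

lemma weight_integrable:
  assumes "0 \<le> l"
  shows "set_integrable lborel {0<..<T} (\<lambda>u. C * u powr - \<alpha> * exp (- l * u))"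
proof (rule set_integrable_bound)
  show "set_integrable lborel {0<..<T} (\<lambda>u. C * u powr - \<alpha>)"
    using set_integrable_powr[of "-\<alpha>" T] alpha T_pos by (intro set_integrable_mult_right) auto
  show "set_borel_measurable lborel {0<..<T} (\<lambda>u. C * u powr - \<alpha> * exp (- l * u))"
    unfolding set_borel_measurable_def by measurable
  show "AE u in lborel. u \<in> {0<..<T} \<longrightarrow>
      norm (C * u powr - \<alpha> * exp (- l * u)) \<le> norm (C * u powr - \<alpha>)"
    using assms C_nonneg by (auto simp: abs_mult intro!: AE_I2 mult_left_le)
qed

text \<open>Since \<open>x powr \<beta> \<le> exp x\<close> for \<open>\<beta> \<le> 1\<close>, a factor \<open>exp (- l * u)\<close> can be
  traded for \<open>(l * u) powr - \<beta>\<close>, which stays integrable against the kernel for small \<open>\<beta>\<close>.\<close>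

lemma kernel_weight_small:
  assumes "0 < e"
  obtains l where "0 < l" "kernel_weight l \<le> e"
proof -
  define \<beta> where "\<beta> = (1 - \<alpha>) / 2"
  have \<beta>: "0 < \<beta>" "\<beta> \<le> 1" "-1 < - (\<alpha> + \<beta>)"
    using alpha by (auto simp: \<beta>_def field_simps)
  define D where "D = (LINT u:{0<..<T}|lborel. u powr - (\<alpha> + \<beta>))"
  have int: "set_integrable lborel {0<..<T} (\<lambda>u. u powr - (\<alpha> + \<beta>))"
    using set_integrable_powr[OF \<beta>(3)] T_pos by auto
  have le: "kernel_weight l \<le> C * D * l powr - \<beta>" if l: "0 < l" for l
  proof -
    have exp_le: "exp (- x) \<le> x powr - \<beta>" if "0 < x" for x :: real
    proof -
      have "x powr \<beta> \<le> max 1 x"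
      proof (cases "x \<le> 1")
        case True
        then show ?thesis using that \<beta> powr_le1[of \<beta> x] by auto
      next
        case False
        then show ?thesis using powr_mono[of \<beta> 1 x] \<beta> by auto
      qed
      also have "\<dots> \<le> exp x" using exp_ge_add_one_self[of x] that by (auto simp del: exp_ge_add_one_self)
      finally show ?thesis using that by (auto simp: exp_minus powr_minus le_imp_inverse_le)
    qed
    have pt: "C * u powr - \<alpha> * exp (- l * u) \<le> C * l powr - \<beta> * u powr - (\<alpha> + \<beta>)"
      if "u \<in> {0<..<T}" for u
    proof -
      have "C * u powr - \<alpha> * exp (- l * u) \<le> C * u powr - \<alpha> * (l * u) powr - \<beta>"
        using exp_le[of "l * u"] that l C_nonneg by (intro mult_left_mono) auto
      also have "\<dots> = C * l powr - \<beta> * u powr - (\<alpha> + \<beta>)"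
        using that l powr_add[of u "-\<alpha>" "-\<beta>"] by (simp add: powr_mult mult_ac)
      finally show ?thesis .
    qed
    have "kernel_weight l \<le> (LINT u:{0<..<T}|lborel. C * l powr - \<beta> * u powr - (\<alpha> + \<beta>))"
      unfolding kernel_weight_def
      using int l pt by (intro set_integral_mono weight_integrable set_integrable_mult_right) auto
    then show ?thesis
      unfolding D_def by (simp add: mult_ac)
  qed
  have "((\<lambda>l. C * D * l powr - \<beta>) \<longlongrightarrow> C * D * 0) at_top"
    using \<beta> by (intro tendsto_mult tendsto_const tendsto_neg_powr filterlim_ident) auto
  then have "\<forall>\<^sub>F l in at_top. C * D * l powr - \<beta> < e"
    using assms by (intro order_tendstoD(2)) auto
  then have "\<forall>\<^sub>F l in at_top. C * D * l powr - \<beta> < e \<and> 0 < l"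
    using eventually_gt_at_top[of 0] by eventually_elim auto
  then obtain l where "C * D * l powr - \<beta> < e" "0 < l"
    unfolding eventually_at_top_linorder by blast
  with le[of l] show ?thesis by (intro that[of l]) auto
qed

lemma integrand_borel_measurable:
  assumes "t \<le> T" "continuous_on {0..t} h"
  shows "(\<lambda>u. indicator {0<..<t} u *\<^sub>R blinfun_apply (S u) (h (t - u))) \<in> borel_measurable borel"
  using assms
  by (intro borel_measurable_continuous_on_indicator continuous_intros
      continuous_on_subset[OF kernel_continuous] continuous_on_compose2[OF assms(2)]) auto

lemma integrand_bound:
  assumes "t \<le> T" "u \<in> {0<..<t}" "norm (h (t - u)) \<le> M"
  shows "norm (blinfun_apply (S u) (h (t - u))) \<le> M * (C * u powr - \<alpha>)"
proof -
  have "norm (blinfun_apply (S u) (h (t - u))) \<le> norm (S u) * norm (h (t - u))"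
    by (rule norm_blinfun)
  also have "\<dots> \<le> (C * u powr - \<alpha>) * M"
    using kernel_bound[of u] assms by (intro mult_mono) (auto intro: order_trans[OF norm_ge_zero])
  finally show ?thesis by (simp add: mult.commute)
qed

lemma duhamel_integrable:
  assumes "t \<le> T" "continuous_on {0..t} h"
  shows "set_integrable lborel {0<..<t} (\<lambda>u. blinfun_apply (S u) (h (t - u)))"
proof -
  obtain M where M: "\<And>s. s \<in> {0..t} \<Longrightarrow> norm (h s) \<le> M"
    using continuous_on_compact_norm_bound[OF assms(2)] by auto
  show ?thesis
  proof (rule set_integrable_bound)
    show "set_integrable lborel {0<..<t} (\<lambda>u. M * (C * u powr - \<alpha>))"
      using assms alpha T_pos
      by (intro set_integrable_mult_right set_integrable_subset[OF set_integrable_powr[of "-\<alpha>" T]]) auto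
    show "set_borel_measurable lborel {0<..<t} (\<lambda>u. blinfun_apply (S u) (h (t - u)))"
      unfolding set_borel_measurable_def using integrand_borel_measurable[OF assms] by simp
    show "AE u in lborel. u \<in> {0<..<t} \<longrightarrow>
        norm (blinfun_apply (S u) (h (t - u))) \<le> norm (M * (C * u powr - \<alpha>))"
      using integrand_bound[OF assms(1)] M by (force intro!: AE_I2 order_trans[OF _ abs_ge_self])
  qed
qed

lemma conv_norm_finite:
  assumes "t \<le> T" "continuous_on {0..t} (\<lambda>s. F (x s))"
  shows "conv_norm S F x t < \<infinity>"
proof -
  let ?f = "\<lambda>u. indicator {0<..<t} u *\<^sub>R blinfun_apply (S u) (F (x (t - u)))"
  have "integrable lborel ?f"
    using duhamel_integrable[OF assms] by (simp add: set_integrable_def)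
  \<comment> \<open>Reflecting once more returns to the variable \<open>s\<close> of
    \<open>conv_norm\<close>.\<close>
  then have "integrable lborel (\<lambda>s. ?f (t + (-1) * s))"
    by (intro lborel_integrable_real_affine) auto
  then have "(\<integral>\<^sup>+ s. ennreal (norm (?f (t + (-1) * s))) \<partial>lborel) < \<infinity>"
    by (simp add: integrable_iff_bounded)
  also have "(\<integral>\<^sup>+ s. ennreal (norm (?f (t + (-1) * s))) \<partial>lborel) = conv_norm S F x t"
    unfolding conv_norm_def by (intro nn_integral_cong) (auto simp: indicator_def)
  finally show ?thesis .
qed

lemma duhamel_diff:
  assumes "t \<le> T" "continuous_on {0..t} h" "continuous_on {0..t} k"
  shows "duhamel S h t - duhamel S k t = duhamel S (\<lambda>s. h s - k s) t"
  unfolding duhamel_def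
  by (simp add: set_integral_diff(2)[OF duhamel_integrable duhamel_integrable, symmetric] assms
      blinfun.diff_right)

text \<open>Since \<open>exp (l * (t - u)) = exp (l * t) * exp (- l * u)\<close>, exponential growth
  of the forcing puts a decaying factor on the kernel; enlarging the domain from \<open>t\<close> to
  \<open>T\<close> then gives \<open>kernel_weight l\<close>.\<close>

lemma duhamel_weighted_bound:
  assumes t: "t \<le> T" and h: "continuous_on {0..t} h" and "0 \<le> l" "0 \<le> K"
    and bound: "\<And>s. s \<in> {0..t} \<Longrightarrow> norm (h s) \<le> K * exp (l * s)"
  shows "norm (duhamel S h t) \<le> K * exp (l * t) * kernel_weight l"
proof -
  have int: "set_integrable lborel {0<..<T} (\<lambda>u. K * exp (l * t) * (C * u powr - \<alpha> * exp (- l * u)))"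
    using assms by (intro set_integrable_mult_right weight_integrable)
  have "norm (duhamel S h t) \<le> (LINT u:{0<..<T}|lborel. K * exp (l * t) * (C * u powr - \<alpha> * exp (- l * u)))"
    unfolding duhamel_def set_lebesgue_integral_def
  proof (rule Bochner_Integration.integral_norm_bound_integral)
    show "integrable lborel (\<lambda>u. indicat_real {0<..<t} u *\<^sub>R blinfun_apply (S u) (h (t - u)))"
      using duhamel_integrable[OF t h] by (simp add: set_integrable_def)
    show "integrable lborel (\<lambda>u. indicat_real {0<..<T} u *\<^sub>R (K * exp (l * t) * (C * u powr - \<alpha> * exp (- l * u))))"
      using int by (simp add: set_integrable_def)
    fix u :: real
    show "norm (indicat_real {0<..<t} u *\<^sub>R blinfun_apply (S u) (h (t - u)))
      \<le> indicat_real {0<..<T} u *\<^sub>R (K * exp (l * t) * (C * u powr - \<alpha> * exp (- l * u)))"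
    proof (cases "u \<in> {0<..<t}")
      case True
      have "norm (blinfun_apply (S u) (h (t - u))) \<le> (K * exp (l * (t - u))) * (C * u powr - \<alpha>)"
        using True by (intro integrand_bound t bound) auto
      also have "\<dots> = K * exp (l * t) * (C * u powr - \<alpha> * exp (- l * u))"
        by (simp add: right_diff_distrib exp_diff exp_minus field_simps)
      finally show ?thesis using True t by simp
    next
      case False
      then show ?thesis using \<open>0 \<le> K\<close> C_nonneg by (auto simp: indicator_def)
    qed
  qed
  then show ?thesis unfolding kernel_weight_def by simp
qed

text \<open>Dominated convergence along sequences: the bound on the forcing times the kernel
  majorant on \<open>{0<..<T}\<close> dominates the integrands for all times at once.\<close>

lemma duhamel_continuous:
  assumes h: "continuous_on {0..T} h"
  shows "continuous_on {0..T} (duhamel S h)"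
proof (rule continuous_on_sequentiallyI)
  fix r :: "nat \<Rightarrow> real" and t
  assume r: "\<forall>n. r n \<in> {0..T}" and t: "t \<in> {0..T}" and lim: "r \<longlonglongrightarrow> t"
  obtain M where M0: "0 < M" and M: "\<And>s. s \<in> {0..T} \<Longrightarrow> norm (h s) \<le> M"
    using continuous_on_compact_norm_bound[OF h] by auto
  have sub: "continuous_on {0..s} h" if "s \<in> {0..T}" for s
    using that by (intro continuous_on_subset[OF h]) auto
  let ?f = "\<lambda>t u. indicator {0<..<t} u *\<^sub>R blinfun_apply (S u) (h (t - u))"
  show "(\<lambda>n. duhamel S h (r n)) \<longlonglongrightarrow> duhamel S h t"
    unfolding duhamel_def set_lebesgue_integral_def
  proof (rule integral_dominated_convergence)
    show "?f t \<in> borel_measurable lborel" "\<And>n. ?f (r n) \<in> borel_measurable lborel"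
      using t r integrand_borel_measurable[OF _ sub] by auto
    \<comment> \<open>For \<open>l = 0\<close> the exponential factor is 1, so
      \<open>weight_integrable\<close> speaks of the bare majorant.\<close>
    show "integrable lborel (\<lambda>u. indicat_real {0<..<T} u *\<^sub>R (M * (C * u powr - \<alpha>)))"
      using set_integrable_mult_right[OF weight_integrable[of 0], of M]
      by (simp add: set_integrable_def)
    show "AE u in lborel. norm (?f (r n) u) \<le> indicat_real {0<..<T} u *\<^sub>R (M * (C * u powr - \<alpha>))" for n
    proof (rule AE_I2)
      fix u
      show "norm (?f (r n) u) \<le> indicat_real {0<..<T} u *\<^sub>R (M * (C * u powr - \<alpha>))"
      proof (cases "u \<in> {0<..<r n}")
        case True
        moreover have "r n \<le> T" using r by auto
        moreover have "norm (h (r n - u)) \<le> M"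
          using True \<open>r n \<le> T\<close> by (intro M) auto
        ultimately show ?thesis
          using integrand_bound[of "r n" u h M] by auto
      next
        case False
        then show ?thesis using M0 C_nonneg by (auto simp: indicator_def)
      qed
    qed
    \<comment> \<open>At \<open>u = t\<close> the indicators of \<open>{0<..<r n}\<close> need not
      converge; this one point is a null set.\<close>
    have "AE u in lborel. u \<noteq> t" by (rule AE_lborel_singleton)
    then show "AE u in lborel. (\<lambda>n. ?f (r n) u) \<longlonglongrightarrow> ?f t u"
    proof eventually_elim
      case (elim u)
      consider "u \<le> 0" | "0 < u" "u < t" | "t < u" using elim by linarith
      then show ?case
      proof cases
        case 1
        then show ?thesis by simp
      next
        case 2
        have ev: "\<forall>\<^sub>F n in sequentially. u < r n" using lim 2 by (intro order_tendstoD(1))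
        have "((\<lambda>n. h (r n - u)) \<longlongrightarrow> h (t - u)) sequentially"
        proof (rule continuous_on_tendsto_compose[OF h])
          show "(\<lambda>n. r n - u) \<longlonglongrightarrow> t - u" by (intro tendsto_intros lim)
          show "t - u \<in> {0..T}" using 2 t by auto
          show "\<forall>\<^sub>F n in sequentially. r n - u \<in> {0..T}"
            using ev
          proof eventually_elim
            case (elim n)
            then show ?case using r[rule_format, of n] 2 by auto
          qed
        qed
        then have "(\<lambda>n. blinfun_apply (S u) (h (r n - u))) \<longlonglongrightarrow> blinfun_apply (S u) (h (t - u))"
          by (intro blinfun.tendsto tendsto_const)
        then have "(\<lambda>n. ?f (r n) u) \<longlonglongrightarrow> blinfun_apply (S u) (h (t - u))"
          by (rule Lim_transform_eventually) (use ev 2 in \<open>auto elim!: eventually_mono\<close>)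
        then show ?thesis using 2 by simp
      next
        case 3
        have "\<forall>\<^sub>F n in sequentially. r n < u" using lim 3 by (intro order_tendstoD(2))
        then have "\<forall>\<^sub>F n in sequentially. ?f (r n) u = 0"
          by eventually_elim auto
        then show ?thesis using 3 by (simp add: tendsto_eventually)
      qed
    qed
  qed
qed

end

section \<open>Initial intervals and the radial truncation\<close>

text \<open>The equation at \<open>t\<close> involves the whole past \<open>{0<..<t}\<close>; this
  closure keeps that past inside the domain, so solutions can be restricted.\<close>

definition initial_interval :: "real set \<Rightarrow> bool" where
  "initial_interval I \<longleftrightarrow> (\<forall>t\<in>I. {0..t} \<subseteq> I)"

lemma initial_intervalD: "initial_interval I \<Longrightarrow> t \<in> I \<Longrightarrow> 0 \<le> s \<Longrightarrow> s \<le> t \<Longrightarrow> s \<in> I"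
  by (auto simp: initial_interval_def subset_eq)

lemma initial_interval_atLeastAtMost: "initial_interval {0..b}"
  and initial_interval_atLeastLessThan: "initial_interval {0..<b}"
  by (auto simp: initial_interval_def)

lemma restrict_in_C_on: "continuous_on J y \<Longrightarrow> restrict y J \<in> C_on J"
  by (auto simp: C_on_def intro: continuous_on_eq)

lemma mild_solution_restrict:
  assumes "mild_solution S F ob I y" "J \<subseteq> I" "initial_interval J"
  shows "mild_solution S F ob J (restrict y J)"
proof -
  have "continuous_on J y"
    using assms by (auto simp: mild_solution_def C_on_def intro: continuous_on_subset)
  then have "restrict y J \<in> C_on J"
    by (rule restrict_in_C_on)
  moreover have "conv_norm S F (restrict y J) t = conv_norm S F y t"
    "conv S F (restrict y J) t = conv S F y t" if "t \<in> J" for t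
    using initial_intervalD[OF assms(3) that] by (intro conv_norm_cong conv_cong; simp)+
  ultimately show ?thesis
    using assms(1,2) unfolding mild_solution_def by (auto simp: subset_eq)
qed

text \<open>The maximum merges the cases inside and outside the ball and keeps the denominator
  positive for \<open>R > 0\<close>.\<close>

definition truncation :: "real \<Rightarrow> 'a::real_normed_vector \<Rightarrow> 'a" where
  "truncation R v = (R / max R (norm v)) *\<^sub>R v"

lemma truncation_eq: "0 < R \<Longrightarrow> norm v \<le> R \<Longrightarrow> truncation R v = v"
  by (simp add: truncation_def max_absorb1)

lemma norm_truncation_le: "0 < R \<Longrightarrow> norm (truncation R v) \<le> R"
  by (auto simp: truncation_def field_simps max_def)

text \<open>Moving the point under a fixed scaling factor and changing the factor at a fixed point
  each cost at most \<open>norm (v - w)\<close>; hence the constant 2 in any normed space.\<close>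

lemma lipschitz_on_truncation:
  assumes "0 < R"
  shows "2-lipschitz_on UNIV (truncation R)"
proof (rule lipschitz_onI)
  fix v w :: 'a
  define p where "p = max R (norm v)"
  define q where "q = max R (norm w)"
  have p: "R \<le> p" "0 < p" and q: "norm w \<le> q" "0 < q"
    using assms by (auto simp: p_def q_def)
  have pq: "\<bar>q - p\<bar> \<le> norm (v - w)"
    using norm_triangle_ineq3[of v w] unfolding p_def q_def by linarith
  have "truncation R v - truncation R w = (R / p) *\<^sub>R (v - w) + (R / p - R / q) *\<^sub>R w"
    by (simp add: truncation_def p_def q_def algebra_simps)
  then have "norm (truncation R v - truncation R w) \<le> (R / p) * norm (v - w) + \<bar>R / p - R / q\<bar> * norm w"
    using norm_triangle_ineq[of "(R / p) *\<^sub>R (v - w)" "(R / p - R / q) *\<^sub>R w"] p assms by simp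
  also have "(R / p) * norm (v - w) \<le> 1 * norm (v - w)"
    using p assms by (intro mult_right_mono) auto
  also have "\<bar>R / p - R / q\<bar> * norm w = (R / p) * (norm w / q) * \<bar>q - p\<bar>"
    using p q assms by (simp add: field_simps abs_mult flip: diff_divide_distrib) (simp add: abs_mult flip: right_diff_distrib)
  also have "\<dots> \<le> 1 * 1 * norm (v - w)"
    using p q pq assms by (intro mult_mono) auto
  finally show "dist (truncation R v) (truncation R w) \<le> 2 * dist v w"
    by (simp add: dist_norm)
qed simp

lemma lipschitz_on_compose_truncation:
  assumes "0 < R" "L-lipschitz_on (cball 0 R) F"
  shows "(L * 2)-lipschitz_on UNIV (\<lambda>v. F (truncation R v))"
  by (rule lipschitz_on_compose2[OF lipschitz_on_truncation[OF assms(1)] lipschitz_on_subset[OF assms(2)]])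
    (auto simp: norm_truncation_le assms)

section \<open>Existence and uniqueness by an exponentially weighted contraction\<close>

context singular_kernel
begin

text \<open>The common estimate behind existence and uniqueness: \<open>B\<close> is the whole space
  for the former and a ball containing both solutions for the latter.\<close>

lemma conv_lipschitz_bound:
  assumes t: "t \<le> T" and F: "continuous_on UNIV F" and L: "L-lipschitz_on B F"
    and y: "continuous_on {0..t} y" "\<And>s. s \<in> {0..t} \<Longrightarrow> y s \<in> B"
    and z: "continuous_on {0..t} z" "\<And>s. s \<in> {0..t} \<Longrightarrow> z s \<in> B"
    and "0 \<le> l" "0 \<le> K" and K: "\<And>s. s \<in> {0..t} \<Longrightarrow> norm (y s - z s) \<le> K * exp (l * s)"
  shows "norm (conv S F y t - conv S F z t) \<le> L * K * exp (l * t) * kernel_weight l"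
proof -
  have c: "continuous_on {0..t} (\<lambda>s. F (y s))" "continuous_on {0..t} (\<lambda>s. F (z s))"
    by (auto intro: continuous_on_compose2[OF F] y z)
  have L0: "0 \<le> L" using L by (rule lipschitz_on_nonneg)
  have "norm (F (y s) - F (z s)) \<le> L * K * exp (l * s)" if "s \<in> {0..t}" for s
  proof -
    have "norm (F (y s) - F (z s)) \<le> L * norm (y s - z s)"
      using that by (intro lipschitz_on_normD[OF L] y z)
    also have "\<dots> \<le> L * (K * exp (l * s))"
      using that by (intro mult_left_mono K L0)
    finally show ?thesis by (simp add: mult.assoc)
  qed
  then show ?thesis
    unfolding conv_eq_duhamel duhamel_diff[OF t c]
    using assms L0 by (intro duhamel_weighted_bound continuous_intros c) auto
qed

lemma contracting_weight:
  assumes "0 \<le> L"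
  obtains l where "0 < l" "L * kernel_weight l \<le> 1 / 2"
proof -
  \<comment> \<open>Dividing by \<open>L + 1\<close> covers \<open>L = 0\<close>.\<close>
  obtain l where l: "0 < l" "kernel_weight l \<le> 1 / (2 * (L + 1))"
    using kernel_weight_small[of "1 / (2 * (L + 1))"] assms by auto
  have "L * kernel_weight l \<le> L * (1 / (2 * (L + 1)))"
    using l assms by (intro mult_left_mono)
  also have "\<dots> \<le> 1 / 2" using assms by (simp add: field_simps)
  finally show ?thesis using l that by blast
qed

text \<open>Banach's fixed point theorem on the bounded continuous functions on the real line. The
  unknown is the solution with its weight divided out, so that the ordinary supremum distance plays
  the role of the weighted one.\<close>

lemma mild_solution_exists_lipschitz:
  assumes L: "L-lipschitz_on UNIV G" and ob: "continuous_on {0..T} ob"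
  shows "\<exists>x. mild_solution S G ob {0..T} x"
proof -
  have G: "continuous_on UNIV G"
    using L by (rule lipschitz_on_continuous_on)
  have L0: "0 \<le> L" using L by (rule lipschitz_on_nonneg)
  obtain l where l: "0 < l" "L * kernel_weight l \<le> 1 / 2"
    using contracting_weight[OF L0] .
  \<comment> \<open>\<open>x f\<close> restores the growth factor, and \<open>rhs\<close> below
    removes it again after the right-hand side has been applied.\<close>
  define x where "x f s = exp (l * s) *\<^sub>R apply_bcontfun f s" for f :: "real \<Rightarrow>\<^sub>C 'v" and s
  have x_cont: "continuous_on A (x f)" for A f
    unfolding x_def by (intro continuous_intros) auto
  define rhs where "rhs f t = exp (- (l * t)) *\<^sub>R (conv S G (x f) t + ob t)" for f t
  have conv_cont: "continuous_on {0..T} (conv S G (x f))" for f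
    using duhamel_continuous[of "\<lambda>s. G (x f s)"]
    by (auto simp: conv_eq_duhamel[abs_def] intro: continuous_on_compose2[OF G x_cont])
  have "continuous_on (cbox 0 T) (rhs f)" for f
    unfolding rhs_def cbox_interval by (intro continuous_intros conv_cont ob)
  \<comment> \<open>\<open>clamp\<close> continues the function from \<open>{0..T}\<close> to the
    line by its boundary values, which keeps it bounded and continuous.\<close>
  then have "\<exists>g :: real \<Rightarrow>\<^sub>C 'v. \<forall>t. apply_bcontfun g t = rhs f (clamp 0 T t)" for f
    by (metis continuous_on_cbox_bcontfunE)
  then obtain \<Phi> :: "(real \<Rightarrow>\<^sub>C 'v) \<Rightarrow> (real \<Rightarrow>\<^sub>C 'v)"
    where \<Phi>: "\<And>f t. apply_bcontfun (\<Phi> f) t = rhs f (clamp 0 T t)"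
    by metis
  have "dist (\<Phi> f) (\<Phi> g) \<le> 1 / 2 * dist f g" for f g
  proof (rule dist_bound)
    fix s
    define t where "t = clamp 0 T s"
    have t: "t \<in> {0..T}"
      using clamp_in_interval[of 0 T s] T_pos by (simp add: t_def)
    have "norm (x f r - x g r) \<le> dist f g * exp (l * r)" for r
      using dist_bounded[of f r g] by (simp add: x_def dist_norm mult.commute flip: scaleR_diff_right)
    then have "norm (conv S G (x f) t - conv S G (x g) t) \<le> L * dist f g * exp (l * t) * kernel_weight l"
      using t l by (intro conv_lipschitz_bound[OF _ G L] x_cont) auto
    then have "exp (- (l * t)) * norm (conv S G (x f) t - conv S G (x g) t)
        \<le> exp (- (l * t)) * (L * dist f g * exp (l * t) * kernel_weight l)"
      by (intro mult_left_mono) auto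
    also have "\<dots> = (L * kernel_weight l) * dist f g"
      by (simp add: exp_minus)
    also have "\<dots> \<le> 1 / 2 * dist f g"
      using l by (intro mult_right_mono) auto
    finally show "dist (apply_bcontfun (\<Phi> f) s) (apply_bcontfun (\<Phi> g) s) \<le> 1 / 2 * dist f g"
      by (simp add: \<Phi> rhs_def dist_norm flip: t_def scaleR_diff_right)
  qed
  then obtain f where f: "\<Phi> f = f"
    using banach_fix_type[of "1 / 2" \<Phi>] by auto
  have eq: "x f t = conv S G (x f) t + ob t" if "t \<in> {0..T}" for t
  proof -
    have "apply_bcontfun f t = rhs f t"
      using \<Phi>[of f t] that by (simp add: f)
    then show ?thesis by (simp add: x_def[of f t] rhs_def exp_minus)
  qed
  have "mild_solution S G ob {0..T} (restrict (x f) {0..T})"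
  proof -
    have "restrict (x f) {0..T} \<in> C_on {0..T}"
      using x_cont by (rule restrict_in_C_on)
    moreover have "conv_norm S G (restrict (x f) {0..T}) t < \<infinity>" if "t \<in> {0..T}" for t
      using that conv_norm_finite[of t G "x f"] continuous_on_compose2[OF G x_cont[of _ f]]
      by (subst conv_norm_cong[where y = "x f" and G = G]) auto
    moreover have "conv S G (restrict (x f) {0..T}) t = conv S G (x f) t" if "t \<in> {0..T}" for t
      using that by (intro conv_cong) auto
    ultimately show ?thesis
      using eq by (auto simp: mild_solution_def)
  qed
  then show ?thesis by blast
qed

text \<open>On a compact \<open>{0..b}\<close> the weighted difference \<open>g\<close> of two
  solutions attains a maximum. The estimate at the maximum point bounds it by half of itself, so it
  vanishes.\<close>

lemma mild_solution_unique:
  assumes F: "continuous_on UNIV F" and lip: "\<And>r. \<exists>L. L-lipschitz_on (cball 0 r) F"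
    and I: "I \<subseteq> {0..T}" "initial_interval I"
    and y: "mild_solution S F ob I y" and z: "mild_solution S F ob I z"
  shows "y = z"
proof (rule extensionalityI[of y I z])
  show "y \<in> extensional I" "z \<in> extensional I"
    using y z by (auto simp: mild_solution_def C_on_def)
  fix b assume b: "b \<in> I"
  have yc: "continuous_on {0..b} y" and zc: "continuous_on {0..b} z"
    using y z I(2) b by (auto simp: mild_solution_def C_on_def initial_interval_def intro: continuous_on_subset)
  obtain M N where M: "\<And>s. s \<in> {0..b} \<Longrightarrow> norm (y s) \<le> M" and N: "\<And>s. s \<in> {0..b} \<Longrightarrow> norm (z s) \<le> N"
    using continuous_on_compact_norm_bound[OF yc] continuous_on_compact_norm_bound[OF zc]
    by (metis compact_Icc)
  \<comment> \<open>Both solutions are bounded on \<open>{0..b}\<close>, so a Lipschitz constant on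
    one ball suffices.\<close>
  obtain L where L: "L-lipschitz_on (cball 0 (max M N)) F" using lip by blast
  obtain l where l: "0 < l" "L * kernel_weight l \<le> 1 / 2"
    using contracting_weight[OF lipschitz_on_nonneg[OF L]] .
  define g where "g t = exp (- (l * t)) * norm (y t - z t)" for t
  have "continuous_on {0..b} g"
    unfolding g_def by (intro continuous_intros yc zc)
  then obtain t where t: "t \<in> {0..b}" and max: "\<And>s. s \<in> {0..b} \<Longrightarrow> g s \<le> g t"
    using continuous_attains_sup[of "{0..b}" g] b I(1) by fastforce
  have g0: "0 \<le> g s" for s by (simp add: g_def)
  have diff: "norm (y s - z s) = g s * exp (l * s)" for s
    by (simp add: g_def exp_minus)
  have tI: "t \<in> I" using t initial_intervalD[OF I(2) b] by auto
  then have "y t - z t = conv S F y t - conv S F z t"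
    using y z by (simp add: mild_solution_def)
  also have "norm \<dots> \<le> L * g t * exp (l * t) * kernel_weight l"
  proof (rule conv_lipschitz_bound[OF _ F L])
    show "continuous_on {0..t} y" "continuous_on {0..t} z"
      using t by (auto intro: continuous_on_subset[OF yc] continuous_on_subset[OF zc])
    show "norm (y s - z s) \<le> g t * exp (l * s)" if "s \<in> {0..t}" for s
      using that t max[of s] by (simp add: diff)
  qed (use t tI I M N l g0 in \<open>force simp: le_max_iff_disj\<close>)+
  finally have "g t * exp (l * t) \<le> L * g t * exp (l * t) * kernel_weight l"
    by (simp add: diff)
  then have "g t * exp (l * t) \<le> (L * kernel_weight l * g t) * exp (l * t)"
    by (simp only: mult_ac)
  then have "g t \<le> (L * kernel_weight l) * g t"
    by (rule mult_right_le_imp_le) simp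
  also have "\<dots> \<le> 1 / 2 * g t" using l g0 by (intro mult_right_mono) auto
  finally have "g b \<le> 0" using max[of b] b I by force
  then have "norm (y b - z b) \<le> 0" using g0[of b] by (simp add: diff)
  then show "y b = z b" by simp
qed

end

text \<open>A path inside the ball of radius \<open>R\<close> is left unchanged by the truncation,
  so both equations have the same integrands along it.\<close>

lemma mild_solution_truncation_iff:
  assumes "0 < R" "\<And>s. s \<in> I \<Longrightarrow> norm (y s) \<le> R" "initial_interval I"
  shows "mild_solution S (\<lambda>v. F (truncation R v)) ob I y \<longleftrightarrow> mild_solution S F ob I y"
proof -
  have "conv_norm S (\<lambda>v. F (truncation R v)) y t = conv_norm S F y t"
    "conv S (\<lambda>v. F (truncation R v)) y t = conv S F y t" if "t \<in> I" for t
  proof -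
    have "F (truncation R (y s)) = F (y s)" if "s \<in> {0<..<t}" for s
      using initial_intervalD[OF assms(3) \<open>t \<in> I\<close>, of s] that assms(1) by (subst truncation_eq) (auto intro!: assms(2))
    then show "conv_norm S (\<lambda>v. F (truncation R v)) y t = conv_norm S F y t"
      "conv S (\<lambda>v. F (truncation R v)) y t = conv S F y t"
      by (auto intro: conv_norm_cong conv_cong)
  qed
  then show ?thesis by (auto simp: mild_solution_def)
qed

section \<open>Extending solutions of the locally Lipschitz problem\<close>

locale mild_problem = singular_kernel S C \<alpha> T
  for S :: "real \<Rightarrow> 'w::real_normed_vector \<Rightarrow>\<^sub>L 'v::{banach, second_countable_topology}"
    and C \<alpha> T :: real +
  fixes F :: "'v \<Rightarrow> 'w" and ob :: "real \<Rightarrow> 'v"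
  assumes F_continuous: "continuous_on UNIV F"
    and F_lipschitz: "\<And>r. \<exists>L. L-lipschitz_on (cball 0 r) F"
    and ob_continuous: "continuous_on {0..T} ob"
begin

lemmas unique = mild_solution_unique[OF F_continuous F_lipschitz]

text \<open>Hides the truncated equation: the extension arguments only need that \<open>z\<close> is
  continuous, that it contains the solutions bounded by \<open>R\<close>, and that it solves the
  original equation as long as it is bounded by \<open>R\<close> itself.\<close>

definition captures_bounded_solutions :: "real \<Rightarrow> (real \<Rightarrow> 'v) \<Rightarrow> bool" where
  "captures_bounded_solutions R z \<longleftrightarrow> continuous_on {0..T} z \<and>
    (\<forall>I y. I \<subseteq> {0..T} \<longrightarrow> initial_interval I \<longrightarrow> mild_solution S F ob I y \<longrightarrow>
      (\<forall>s\<in>I. norm (y s) \<le> R) \<longrightarrow> y = restrict z I) \<and>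
    (\<forall>I. I \<subseteq> {0..T} \<longrightarrow> initial_interval I \<longrightarrow> (\<forall>s\<in>I. norm (z s) \<le> R) \<longrightarrow>
      mild_solution S F ob I (restrict z I))"

lemma captures_bounded_solutionsD:
  assumes "captures_bounded_solutions R z"
  shows "continuous_on {0..T} z"
    and "I \<subseteq> {0..T} \<Longrightarrow> initial_interval I \<Longrightarrow> mild_solution S F ob I y \<Longrightarrow>
      (\<And>s. s \<in> I \<Longrightarrow> norm (y s) \<le> R) \<Longrightarrow> y = restrict z I"
    and "I \<subseteq> {0..T} \<Longrightarrow> initial_interval I \<Longrightarrow> (\<And>s. s \<in> I \<Longrightarrow> norm (z s) \<le> R) \<Longrightarrow>
      mild_solution S F ob I (restrict z I)"
  using assms unfolding captures_bounded_solutions_def by auto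

text \<open>The witness is the global solution of the truncated equation. Uniqueness for that
  equation identifies it with each solution bounded by \<open>R\<close>.\<close>

lemma captures_bounded_solutions_exists:
  assumes "0 < R"
  shows "\<exists>z. captures_bounded_solutions R z"
proof -
  let ?G = "\<lambda>v. F (truncation R v)"
  obtain L where "L-lipschitz_on (cball 0 R) F" using F_lipschitz by blast
  then have lip: "(L * 2)-lipschitz_on UNIV ?G"
    by (rule lipschitz_on_compose_truncation[OF assms])
  have G: "continuous_on UNIV ?G" "\<exists>L. L-lipschitz_on (cball 0 r) ?G" for r
    using lipschitz_on_continuous_on[OF lip] lipschitz_on_subset[OF lip] by blast+
  obtain z where z: "mild_solution S ?G ob {0..T} z"
    using mild_solution_exists_lipschitz[OF lip ob_continuous] by blast
  show ?thesis
    unfolding captures_bounded_solutions_def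
  proof (intro exI[of _ z] conjI allI impI)
    show "continuous_on {0..T} z"
      using z by (auto simp: mild_solution_def C_on_def)
    fix I assume I: "I \<subseteq> {0..T}" "initial_interval I"
    have zI: "mild_solution S ?G ob I (restrict z I)"
      by (rule mild_solution_restrict[OF z I])
    show "y = restrict z I" if "mild_solution S F ob I y" "\<forall>s\<in>I. norm (y s) \<le> R" for y
      using that mild_solution_truncation_iff[of R I y S F ob] assms I
      by (intro mild_solution_unique[OF G I _ zI]) auto
    show "mild_solution S F ob I (restrict z I)" if "\<forall>s\<in>I. norm (z s) \<le> R"
      using that mild_solution_truncation_iff[of R I "restrict z I" S F ob] assms I zI by auto
  qed
qed

text \<open>The capturing function is already continuous at \<open>c\<close>, and the norm bound
  passes to the closure, so it still solves the equation on \<open>{0..c}\<close>.\<close>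

lemma extend_to_endpoint:
  assumes c: "0 < c" "c \<le> T" and y: "mild_solution S F ob {0..<c} y"
    and R: "\<And>s. s \<in> {0..<c} \<Longrightarrow> norm (y s) \<le> R"
  shows "\<exists>z. mild_solution S F ob {0..c} z"
proof -
  \<comment> \<open>\<open>R\<close> may be 0, but the truncation radius has to be positive.\<close>
  have R': "0 < max R 1" "\<And>s. s \<in> {0..<c} \<Longrightarrow> norm (y s) \<le> max R 1"
    using R by (auto simp: le_max_iff_disj)
  obtain z where "captures_bounded_solutions (max R 1) z"
    using captures_bounded_solutions_exists[OF R'(1)] by blast
  note z = captures_bounded_solutionsD[OF this]
  have "y = restrict z {0..<c}"
    by (rule z(2)[OF _ initial_interval_atLeastLessThan y]) (use c R' in auto)
  then have zR: "norm (z s) \<le> max R 1" if "s \<in> {0..<c}" for s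
    using R'(2)[OF that] that by simp
  have cl: "closure {0..<c} = {0..c}" using c by simp
  have "norm (z s) \<le> max R 1" if "s \<in> {0..c}" for s
    using continuous_on_closure_norm_le[of "{0..<c}" z "max R 1" s] zR that c
      continuous_on_subset[OF z(1), of "{0..c}"] by (simp add: cl)
  then have "mild_solution S F ob {0..c} (restrict z {0..c})"
    by (intro z(3) initial_interval_atLeastAtMost) (use c in auto)
  then show ?thesis by blast
qed

text \<open>A radius larger by 1 than the bound on \<open>{0..b}\<close> leaves room: by continuity
  the capturing function stays below that radius for a short time after \<open>b\<close>.\<close>

lemma extend_beyond:
  assumes b: "0 \<le> b" "b < T" and y: "mild_solution S F ob {0..b} y"
  shows "\<exists>b'>b. b' \<le> T \<and> (\<exists>z. mild_solution S F ob {0..b'} z)"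
proof -
  have "continuous_on {0..b} y" using y by (auto simp: mild_solution_def C_on_def)
  then obtain M where M: "0 < M" "\<And>s. s \<in> {0..b} \<Longrightarrow> norm (y s) \<le> M"
    using continuous_on_compact_norm_bound compact_Icc by blast
  then have M1: "0 < M + 1" by simp
  obtain z where "captures_bounded_solutions (M + 1) z"
    using captures_bounded_solutions_exists[OF M1] by blast
  note z = captures_bounded_solutionsD[OF this]
  have "y = restrict z {0..b}"
    by (rule z(2)[OF _ initial_interval_atLeastAtMost y]) (use b M in \<open>force+\<close>)
  then have zM: "norm (z s) \<le> M" if "s \<in> {0..b}" for s
    using M(2)[OF that] that by simp
  obtain d where d: "0 < d" "\<And>s. s \<in> {0..T} \<Longrightarrow> dist s b < d \<Longrightarrow> dist (z s) (z b) < 1"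
    using z(1) b unfolding continuous_on_iff by (metis atLeastAtMost_iff less_eq_real_def zero_less_one)
  \<comment> \<open>Halving \<open>d\<close> keeps \<open>b'\<close> strictly inside the
    neighbourhood of \<open>b\<close> where \<open>z\<close> moves by less than 1.\<close>
  define b' where "b' = min T (b + d / 2)"
  have b': "b < b'" "b' \<le> T" "b' < b + d" using b d by (auto simp: b'_def)
  have "norm (z s) \<le> M + 1" if s: "s \<in> {0..b'}" for s
  proof (cases "s \<le> b")
    case True
    then show ?thesis using zM[of s] s by simp
  next
    case False
    then have "dist (z s) (z b) < 1"
      using s b' by (intro d) (auto simp: dist_real_def)
    then show ?thesis
      using zM[of b] b norm_triangle_ineq2[of "z s" "z b"] by (simp add: dist_norm)
  qed
  then have "mild_solution S F ob {0..b'} (restrict z {0..b'})"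
    by (intro z(3) initial_interval_atLeastAtMost) (use b' in auto)
  with b' show ?thesis by blast
qed

end

section \<open>Left limits superior at the end of an interval\<close>

lemma initial_intervalI:
  assumes "convex J" "0 \<in> J" "J \<subseteq> {0..}"
  shows "initial_interval J"
proof -
  have "{0..t} \<subseteq> J" if "t \<in> J" for t
    using that assms closed_segment_subset[of 0 J t] closed_segment_eq_real_ivl[of 0 t] by auto
  then show ?thesis by (auto simp: initial_interval_def)
qed

text \<open>The filter leaves out the endpoint, so closed and half-open intervals can be treated
  alike.\<close>

lemma left_Limsup_segment:
  assumes "0 < c" "J = {0..c} \<or> J = {0..<c}"
  shows "left_Limsup J f = Limsup (at c within {0..<c}) f"
proof -
  have "Sup J = c" "{s \<in> J. s < c} = {0..<c}" using assms by auto
  then show ?thesis by (simp add: left_Limsup_def)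
qed

text \<open>Nontriviality of the filter is what permits bounding a \<open>Limsup\<close> from
  below.\<close>

lemma at_within_segment_neq_bot: "0 < c \<Longrightarrow> at c within {0..<c} \<noteq> bot" for c :: real
  by (subst at_within_nhd[of c "{0<..}" _ "{..<c}"]) (auto simp: trivial_limit_at_left_real)

text \<open>Within distance \<open>1 / r\<close> of \<open>T\<close> the first term alone exceeds
  \<open>r\<close>. This settles the blow-up condition for solutions that live up to
  \<open>T\<close>.\<close>

lemma Limsup_inverse_distance:
  fixes T :: real
  assumes "0 < T" "\<And>s. 0 \<le> g s"
  shows "Limsup (at T within {0..<T}) (\<lambda>s. ennreal (1 / (T - s) + g s)) = \<infinity>"
proof -
  have ge: "ennreal r \<le> Limsup (at T within {0..<T}) (\<lambda>s. ennreal (1 / (T - s) + g s))" if "0 < r" for r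
  proof (rule le_Limsup[OF at_within_segment_neq_bot[OF assms(1)]])
    show "\<forall>\<^sub>F s in at T within {0..<T}. ennreal r \<le> ennreal (1 / (T - s) + g s)"
      unfolding eventually_at
    proof (intro exI[of _ "1 / r"] conjI ballI impI)
      fix s assume s: "s \<in> {0..<T}" "s \<noteq> T \<and> dist s T < 1 / r"
      then have "r \<le> 1 / (T - s)"
        using that by (auto simp: dist_real_def field_simps)
      then show "ennreal r \<le> ennreal (1 / (T - s) + g s)"
        using assms(2)[of s] by (intro ennreal_leI) linarith
    qed (use that in auto)
  qed
  have "Limsup (at T within {0..<T}) (\<lambda>s. ennreal (1 / (T - s) + g s)) \<noteq> ennreal q"
    if "0 \<le> q" for q
    using ge[of "q + 1"] ennreal_lessI[of "q + 1" q] that by (auto simp: not_le[symmetric] simp del: ennreal_plus)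
  then show ?thesis
    by (metis ennreal_cases infinity_ennreal_def)
qed

text \<open>Near \<open>c\<close> the finite limit superior bounds the norm; the remaining part of
  the interval is compact.\<close>

lemma bounded_of_Limsup:
  fixes y :: "real \<Rightarrow> 'a::real_normed_vector"
  assumes y: "continuous_on {0..<c} y"
    and Limsup: "Limsup (at c within {0..<c}) (\<lambda>s. ennreal (norm (y s))) < \<infinity>"
  obtains R where "\<And>s. s \<in> {0..<c} \<Longrightarrow> norm (y s) \<le> R"
proof -
  obtain q where q: "0 \<le> q" "Limsup (at c within {0..<c}) (\<lambda>s. ennreal (norm (y s))) = ennreal q"
    using Limsup by (metis ennreal_cases less_irrefl infinity_ennreal_def)
  then have "Limsup (at c within {0..<c}) (\<lambda>s. ennreal (norm (y s))) < ennreal (q + 1)"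
    by (simp add: ennreal_lessI)
  then have "\<forall>\<^sub>F s in at c within {0..<c}. ennreal (norm (y s)) < ennreal (q + 1)"
    by (rule Limsup_lessD)
  then obtain d where d: "0 < d"
    "\<And>s. s \<in> {0..<c} \<Longrightarrow> dist s c < d \<Longrightarrow> ennreal (norm (y s)) < ennreal (q + 1)"
    unfolding eventually_at by fastforce
  \<comment> \<open>This interval may be empty; together with the points closer to \<open>c\<close>
    than \<open>d\<close> it always covers \<open>{0..<c}\<close>.\<close>
  have "continuous_on {0..c - d / 2} y"
    using d(1) by (intro continuous_on_subset[OF y]) auto
  then obtain M where M: "0 < M" "\<And>s. s \<in> {0..c - d / 2} \<Longrightarrow> norm (y s) \<le> M"
    using continuous_on_compact_norm_bound compact_Icc by blast
  have "norm (y s) \<le> max M (q + 1)" if s: "s \<in> {0..<c}" for s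
  proof (cases "s \<le> c - d / 2")
    case True
    then show ?thesis using M(2)[of s] s by auto
  next
    case False
    then have "ennreal (norm (y s)) < ennreal (q + 1)"
      using s d by (auto simp: dist_real_def)
    then have "norm (y s) < q + 1" using q by (subst (asm) ennreal_less_iff) auto
    then show ?thesis by auto
  qed
  then show thesis by (rule that)
qed

section \<open>The maximal interval of existence\<close>

context mild_problem
begin

definition existence_times :: "real set" where
  "existence_times = {b \<in> {0..T}. \<exists>x. mild_solution S F ob {0..b} x}"

lemma initial_interval_existence_times: "initial_interval existence_times"
proof -
  have "s \<in> existence_times" if b: "b \<in> existence_times" and s: "s \<in> {0..b}" for s b
  proof -
    obtain x where "mild_solution S F ob {0..b} x"
      using b by (auto simp: existence_times_def)
    then have "mild_solution S F ob {0..s} (restrict x {0..s})"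
      by (rule mild_solution_restrict) (use s initial_interval_atLeastAtMost in auto)
    then show ?thesis using b s by (auto simp: existence_times_def)
  qed
  then show ?thesis by (auto simp: initial_interval_def)
qed

lemma zero_in_existence_times: "0 \<in> existence_times"
proof -
  have "mild_solution S F ob {0..0} (restrict ob {0..0})"
    using restrict_in_C_on[of "{0}" ob] by (simp add: mild_solution_def conv_def conv_norm_def set_lebesgue_integral_def)
  then show ?thesis using T_pos by (auto simp: existence_times_def)
qed

text \<open>An existence time below \<open>T\<close> can always be passed by
  \<open>extend_beyond\<close>. If \<open>T\<close> is missing, there is thus no greatest existence
  time, and the supremum is an excluded endpoint.\<close>

lemma existence_times_cases:
  obtains "existence_times = {0..T}"
  | c where "0 < c" "c \<le> T" "existence_times = {0..<c}"
proof (cases "T \<in> existence_times")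
  case True
  then have "existence_times = {0..T}"
    using initial_interval_existence_times by (auto simp: existence_times_def initial_interval_def)
  then show ?thesis using that by blast
next
  case False
  have beyond: "\<exists>b'\<in>existence_times. b < b'" if b: "b \<in> existence_times" for b
  proof -
    have "0 \<le> b" "b < T" using b False by (auto simp: existence_times_def less_le)
    moreover obtain y where "mild_solution S F ob {0..b} y"
      using b by (auto simp: existence_times_def)
    ultimately obtain b' z where "b < b'" "b' \<le> T" "mild_solution S F ob {0..b'} z"
      using extend_beyond by blast
    then show ?thesis using \<open>0 \<le> b\<close> by (intro bexI[of _ b']) (auto simp: existence_times_def)
  qed
  have bdd: "bdd_above existence_times"
    by (rule bdd_above.I[of _ T]) (auto simp: existence_times_def)
  define c where "c = Sup existence_times"
  have less: "b < c" if b: "b \<in> existence_times" for b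
  proof -
    obtain b' where "b' \<in> existence_times" "b < b'" using beyond[OF b] by blast
    then show ?thesis using cSup_upper[OF _ bdd, of b'] by (simp add: c_def)
  qed
  have "existence_times = {0..<c}"
  proof (intro equalityI subsetI)
    fix b assume "b \<in> existence_times"
    then show "b \<in> {0..<c}" using less by (auto simp: existence_times_def)
  next
    fix b assume b: "b \<in> {0..<c}"
    then obtain b' where "b' \<in> existence_times" "b < b'"
      using less_cSup_iff[OF _ bdd, of b] zero_in_existence_times by (auto simp: c_def)
    then show "b \<in> existence_times"
      using initial_intervalD[OF initial_interval_existence_times, of b' b] b by auto
  qed
  moreover have "0 < c" using less[OF zero_in_existence_times] .
  moreover have "c \<le> T"
    unfolding c_def
  proof (rule cSup_least)
    show "existence_times \<noteq> {}" using zero_in_existence_times by blast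
  qed (auto simp: existence_times_def)
  ultimately show ?thesis using that by blast
qed

text \<open>In the half-open case a bounded solution would extend to \<open>c\<close> and make
  \<open>c\<close> an existence time, which is absurd.\<close>

lemma existence_times_eq_if_bounded:
  assumes y: "mild_solution S F ob existence_times y"
    and Limsup: "left_Limsup existence_times (\<lambda>s. ennreal (norm (y s))) < \<infinity>"
  shows "existence_times = {0..T}"
proof (rule existence_times_cases)
  fix c assume c: "0 < c" "c \<le> T" and eq: "existence_times = {0..<c}"
  have y': "mild_solution S F ob {0..<c} y" using y by (simp add: eq)
  then have "continuous_on {0..<c} y" by (simp add: mild_solution_def C_on_def)
  then obtain R where "\<And>s. s \<in> {0..<c} \<Longrightarrow> norm (y s) \<le> R"
    by (rule bounded_of_Limsup) (use Limsup left_Limsup_segment[of c existence_times] c eq in auto)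
  then have "\<exists>z. mild_solution S F ob {0..c} z" by (rule extend_to_endpoint[OF c y'])
  then have "c \<in> existence_times" using c by (simp add: existence_times_def)
  then show ?thesis by (simp add: eq)
qed

text \<open>In the half-open case the solutions on the intervals \<open>{0..b}\<close> are glued;
  uniqueness makes them agree on overlaps.\<close>

lemma mild_solution_existence_times: "\<exists>x. mild_solution S F ob existence_times x"
proof (rule existence_times_cases)
  assume eq: "existence_times = {0..T}"
  have "T \<in> existence_times" using T_pos by (simp add: eq)
  then show ?thesis by (subst eq) (simp add: existence_times_def)
next
  fix c assume c: "0 < c" "c \<le> T" and eq: "existence_times = {0..<c}"
  have "\<exists>x. mild_solution S F ob {0..b} x" if "b \<in> {0..<c}" for b
    using that unfolding eq[symmetric] by (simp add: existence_times_def)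
  then obtain sol where sol: "\<And>b. b \<in> {0..<c} \<Longrightarrow> mild_solution S F ob {0..b} (sol b)"
    by metis
  \<comment> \<open>The diagonal picks at each time the final value of the solution up to that
    time.\<close>
  define x where "x t = sol t t" for t
  have x_eq: "x s = sol b s" if b: "b \<in> {0..<c}" and s: "s \<in> {0..b}" for b s
  proof -
    have "mild_solution S F ob {0..s} (restrict (sol b) {0..s})"
      by (rule mild_solution_restrict[OF sol[OF b]]) (use s initial_interval_atLeastAtMost in auto)
    then have "sol s = restrict (sol b) {0..s}"
      by (intro unique[OF _ initial_interval_atLeastAtMost sol]) (use b s c in auto)
    then show ?thesis using s by (simp add: x_def)
  qed
  have "continuous_on {0..<c} x"
    unfolding continuous_on_eq_continuous_within
  proof
    fix t assume t: "t \<in> {0..<c}"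
    \<comment> \<open>A point strictly beyond \<open>t\<close> makes \<open>{0..b}\<close> a
      neighbourhood of \<open>t\<close> in \<open>{0..<c}\<close>, so continuity of
      \<open>sol b\<close> transfers.\<close>
    define b where "b = (t + c) / 2"
    have b: "b \<in> {0..<c}" "t < b" using t by (auto simp: b_def field_simps)
    have "continuous_on {0..b} (sol b)"
      using sol[OF b(1)] by (simp add: mild_solution_def C_on_def)
    then have "continuous_on {0..b} x"
      by (rule continuous_on_eq) (use x_eq[OF b(1)] in auto)
    then have "continuous (at t within {0..b}) x"
      using t b by (auto simp: continuous_on_eq_continuous_within)
    moreover have "at t within {0..<c} = at t within {0..b}"
      by (rule at_within_nhd[of t "{..<b}"]) (use t b in auto)
    ultimately show "continuous (at t within {0..<c}) x" by simp
  qed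
  then have "restrict x {0..<c} \<in> C_on {0..<c}" by (rule restrict_in_C_on)
  moreover have "conv_norm S F (restrict x {0..<c}) t = conv_norm S F (sol t) t"
    "conv S F (restrict x {0..<c}) t = conv S F (sol t) t" if "t \<in> {0..<c}" for t
    using that x_eq[OF that] by (intro conv_norm_cong conv_cong; simp)+
  moreover have "conv_norm S F (sol t) t < \<infinity>" "sol t t = conv S F (sol t) t + ob t"
    if "t \<in> {0..<c}" for t
    using sol[OF that] that by (auto simp: mild_solution_def)
  ultimately have "mild_solution S F ob {0..<c} (restrict x {0..<c})"
    by (auto simp: mild_solution_def x_def)
  then show ?thesis unfolding eq by blast
qed

text \<open>A finite value would also bound the limit superior of the norm alone and force the
  interval to be \<open>{0..T}\<close>; but there the term \<open>1 / (T - s)\<close>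
  diverges.\<close>

lemma blow_up:
  assumes x: "mild_solution S F ob existence_times x"
  shows "left_Limsup existence_times (\<lambda>s. ennreal (1 / (T - s) + norm (x s))) = \<infinity>"
proof (rule ccontr)
  assume neq: "\<not> ?thesis"
  obtain c where c: "0 < c" "c \<le> T" "existence_times = {0..c} \<or> existence_times = {0..<c}"
    using existence_times_cases T_pos by (metis order_refl)
  have mono: "left_Limsup existence_times (\<lambda>s. ennreal (norm (x s)))
      \<le> left_Limsup existence_times (\<lambda>s. ennreal (1 / (T - s) + norm (x s)))"
    unfolding left_Limsup_segment[OF c(1,3)]
  proof (rule Limsup_mono)
    have "ennreal (norm (x s)) \<le> ennreal (1 / (T - s) + norm (x s))" if "s \<in> {0..<c}" for s
      using that c by (intro ennreal_leI) auto
    then show "\<forall>\<^sub>F s in at c within {0..<c}. ennreal (norm (x s)) \<le> ennreal (1 / (T - s) + norm (x s))"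
      by (auto simp: eventually_at_filter)
  qed
  also have "\<dots> < \<infinity>" using neq by (simp add: less_top)
  finally have eq: "existence_times = {0..T}"
    by (rule existence_times_eq_if_bounded[OF x])
  show False
    using neq Limsup_inverse_distance[OF T_pos, of "\<lambda>s. norm (x s)"]
      left_Limsup_segment[OF T_pos, of existence_times] eq by simp
qed

text \<open>By \<open>blow_up\<close> the limit superior is automatically infinite on this interval,
  and lying below it then means just that the integral is finite.\<close>

lemma maximal_mild_solution_iff:
  "maximal_mild_solution T S F ob existence_times x \<longleftrightarrow> mild_solution S F ob existence_times x"
proof
  assume "maximal_mild_solution T S F ob existence_times x"
  then show "mild_solution S F ob existence_times x"
    unfolding maximal_mild_solution_def mild_solution_def by (auto simp: less_top)
next
  assume "mild_solution S F ob existence_times x"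
  then show "maximal_mild_solution T S F ob existence_times x"
    using blow_up[of x] unfolding maximal_mild_solution_def mild_solution_def by auto
qed

text \<open>A solution on any admissible interval restricts to each \<open>{0..t}\<close> inside it,
  so all its points are existence times. This rules out proper extensions of
  \<open>existence_times\<close>, and any competing \<open>J\<close> lies inside it, where its own
  clause on larger domains forces equality.\<close>

lemma unique_maximal_interval:
  "\<exists>!J. convex J \<and> J \<subseteq> {0..T} \<and> {0} \<subset> J
    \<and> (\<exists>!x. maximal_mild_solution T S F ob J x)
    \<and> (\<forall>x. maximal_mild_solution T S F ob J x \<longrightarrow>
          (\<forall>I y. convex I \<and> I \<subseteq> {0..T} \<and> J \<subseteq> I \<and> mild_solution S F ob I y \<longrightarrow> I = J \<and> x = y))
    \<and> (\<forall>y. mild_solution S F ob J y \<and> left_Limsup J (\<lambda>s. ennreal (norm (y s))) < \<infinity> \<longrightarrow> J = {0..T})"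
  (is "\<exists>!J. ?P J")
proof (rule ex1I)
  have sub: "existence_times \<subseteq> {0..T}" by (auto simp: existence_times_def)
  have uniq: "x = y" if "mild_solution S F ob existence_times x" "mild_solution S F ob existence_times y" for x y
    using unique[OF sub initial_interval_existence_times that] .
  show "?P existence_times"
  proof (intro conjI allI impI; (elim conjE)?)
    show "convex existence_times"
      by (rule existence_times_cases) auto
    have "\<exists>b\<in>existence_times. 0 < b"
    proof (rule existence_times_cases)
      show ?thesis if "existence_times = {0..T}" using that T_pos by auto
      show ?thesis if "0 < c" "existence_times = {0..<c}" for c
        using that by (intro bexI[of _ "c / 2"]) auto
    qed
    then obtain b where b: "b \<in> existence_times" "0 < b" by blast
    then have "b \<notin> {0}" by simp
    with b zero_in_existence_times show "{0} \<subset> existence_times" by blast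
    show "\<exists>!x. maximal_mild_solution T S F ob existence_times x"
      unfolding maximal_mild_solution_iff using mild_solution_existence_times uniq by blast
    show "existence_times \<subseteq> {0..T}" by fact
    fix x I y
    assume x: "maximal_mild_solution T S F ob existence_times x"
      and I: "convex I" "I \<subseteq> {0..T}" "existence_times \<subseteq> I" and y: "mild_solution S F ob I y"
    have init: "initial_interval I"
      using I zero_in_existence_times by (intro initial_intervalI) auto
    have "t \<in> existence_times" if t: "t \<in> I" for t
    proof -
      have "mild_solution S F ob {0..t} (restrict y {0..t})"
        using t init by (intro mild_solution_restrict[OF y] initial_interval_atLeastAtMost)
          (auto simp: initial_interval_def)
      then show ?thesis using t I by (auto simp: existence_times_def)
    qed
    then show eq: "I = existence_times" using I by blast
    show "x = y" using x y uniq unfolding maximal_mild_solution_iff eq by blast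
  next
    fix y assume "mild_solution S F ob existence_times y"
      "left_Limsup existence_times (\<lambda>s. ennreal (norm (y s))) < \<infinity>"
    then show "existence_times = {0..T}" by (rule existence_times_eq_if_bounded)
  qed
  fix J assume J: "?P J"
  then obtain x where x: "maximal_mild_solution T S F ob J x" by blast
  then have mild: "mild_solution S F ob J x"
    unfolding maximal_mild_solution_def mild_solution_def by (auto simp: less_top)
  have init: "initial_interval J" using J by (intro initial_intervalI) auto
  have "J \<subseteq> existence_times"
  proof
    fix t assume t: "t \<in> J"
    have "mild_solution S F ob {0..t} (restrict x {0..t})"
      using t init by (intro mild_solution_restrict[OF mild] initial_interval_atLeastAtMost)
        (auto simp: initial_interval_def)
    then show "t \<in> existence_times" using t J by (auto simp: existence_times_def)
  qed
  moreover obtain z where "mild_solution S F ob existence_times z"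
    using mild_solution_existence_times by blast
  moreover have "convex existence_times" by (rule existence_times_cases) auto
  \<comment> \<open>The projections select from \<open>?P J\<close> the clause on solutions with
    larger domain, applied to the domain \<open>existence_times\<close>.\<close>
  ultimately have "existence_times = J"
    using J[THEN conjunct2, THEN conjunct2, THEN conjunct2, THEN conjunct2, THEN conjunct1,
        rule_format, OF x, of existence_times z] sub by simp
  then show "J = existence_times" ..
qed

end

section \<open>Reading the properties of \<open>F\<close> and \<open>S\<close> off the
  hypotheses\<close>

lemma le_enn2real:
  assumes "ennreal x \<le> X" "X < \<infinity>"
  shows "x \<le> enn2real X"
  using assms by (cases X) (auto simp: ennreal_le_iff)

text \<open>Two points of the ball of radius \<open>r\<close> have norms adding up to at most
  \<open>2 * r\<close>, so the supremum serves as a Lipschitz constant.\<close>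

lemma lipschitz_on_of_Sup_quotients:
  fixes F :: "'a::real_normed_vector \<Rightarrow> 'b::real_normed_vector"
  assumes "Sup ({ennreal (norm (F v - F w) / norm (v - w)) | v w. v \<noteq> w \<and> norm v + norm w \<le> 2 * r} \<union> {0}) < \<infinity>"
    (is "Sup ?Q < \<infinity>")
  shows "\<exists>L. L-lipschitz_on (cball 0 r) F"
proof (intro exI lipschitz_onI)
  fix v w :: 'a assume vw: "v \<in> cball 0 r" "w \<in> cball 0 r"
  show "dist (F v) (F w) \<le> enn2real (Sup ?Q) * dist v w"
  proof (cases "v = w")
    case False
    have "ennreal (norm (F v - F w) / norm (v - w)) \<le> Sup ?Q"
      using vw False by (intro Sup_upper UnI1 CollectI exI[of _ v] exI[of _ w]) auto
    then have "norm (F v - F w) / norm (v - w) \<le> enn2real (Sup ?Q)"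
      using assms by (rule le_enn2real)
    then show ?thesis using False by (simp add: dist_norm field_simps)
  qed simp
qed simp

text \<open>The modulus is singular only in the left one of two times. Near \<open>t\<close> both
  times stay above \<open>t / 2\<close>, where the singular factor is bounded by the constant
  \<open>K\<close>.\<close>

lemma continuous_on_of_modulus:
  fixes S :: "real \<Rightarrow> 'a::real_normed_vector" and \<phi> :: "real \<Rightarrow> real"
  assumes bound: "\<And>s t. 0 < s \<Longrightarrow> s < t \<Longrightarrow> t < T \<Longrightarrow> norm (S t - S s) \<le> C * s powr - \<alpha> * \<phi> (t - s)"
    and "0 \<le> C" "0 \<le> \<alpha>" and pos: "\<And>t. t \<in> {0<..<T} \<Longrightarrow> 0 < \<phi> t"
    and lim: "(\<phi> \<longlongrightarrow> 0) (at_right 0)"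
  shows "continuous_on {0<..<T} S"
  unfolding continuous_on_iff
proof (intro ballI allI impI)
  fix t e :: real assume t: "t \<in> {0<..<T}" and e: "0 < e"
  define K where "K = C * (t / 2) powr - \<alpha>"
  have K: "0 \<le> K" using \<open>0 \<le> C\<close> by (simp add: K_def)
  \<comment> \<open>Dividing by \<open>K + 1\<close> covers \<open>K = 0\<close> and makes the final
    estimate strict.\<close>
  have "\<forall>\<^sub>F h in at_right 0. \<phi> h < e / (K + 1)"
    using lim e K by (intro order_tendstoD(2)) auto
  then obtain d where d: "0 < d" "\<And>h. 0 < h \<Longrightarrow> h < d \<Longrightarrow> \<phi> h < e / (K + 1)"
    by (auto simp: eventually_at_right[OF zero_less_one])
  have small: "norm (S b - S a) < e" if ab: "t / 2 \<le> a" "a < b" "b < T" "b - a < d" for a b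
  proof -
    have a: "0 < a" using ab t by auto
    have "a powr - \<alpha> \<le> (t / 2) powr - \<alpha>"
      using ab t \<open>0 \<le> \<alpha>\<close> by (intro powr_mono2') auto
    then have "C * a powr - \<alpha> * \<phi> (b - a) \<le> K * \<phi> (b - a)"
      unfolding K_def using pos[of "b - a"] ab a \<open>0 \<le> C\<close> by (intro mult_right_mono mult_left_mono) auto
    also have "\<dots> \<le> K * (e / (K + 1))"
      using d(2)[of "b - a"] ab K by (intro mult_left_mono) auto
    also have "\<dots> < e" using K e by (simp add: field_simps)
    finally show ?thesis using bound[of a b] a ab by linarith
  qed
  show "\<exists>d>0. \<forall>x\<in>{0<..<T}. dist x t < d \<longrightarrow> dist (S x) (S t) < e"
  proof (intro exI[of _ "min d (t / 2)"] conjI ballI impI)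
    fix x assume x: "x \<in> {0<..<T}" "dist x t < min d (t / 2)"
    then show "dist (S x) (S t) < e"
      using small[of x t] small[of t x] t e
      by (cases x t rule: linorder_cases) (auto simp: dist_norm dist_real_def norm_minus_commute abs_if)
  qed (use d t in auto)
qed

theorem corollary8p4:
  fixes T :: real
    and F :: "'v::{banach, second_countable_topology} \<Rightarrow> 'w::banach"
    and ob :: "real \<Rightarrow> 'v"
    and S :: "real \<Rightarrow> 'w \<Rightarrow>\<^sub>L 'v"
    and \<S> :: "real \<Rightarrow> 'v \<Rightarrow>\<^sub>L 'v"
    and \<phi> :: "real \<Rightarrow> real"
  assumes "0 < T"
    and "continuous_on UNIV F"
    and "continuous_on {0..T} ob"
    and "S \<in> borel_measurable (restrict_space borel {0<..<T})"
    and "\<S> \<in> borel_measurable (restrict_space borel {0..T})"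
    and "\<And>t. t \<in> {0<..<T} \<Longrightarrow> 0 < \<phi> t"
    and "\<And>v. continuous_on {0..T} (\<lambda>t. blinfun_apply (\<S> t) v)"
    and "\<And>t1 t2. t1 \<in> {0..<T} \<Longrightarrow> t2 \<in> {0<..<T - t1} \<Longrightarrow> S (t1 + t2) = \<S> t1 o\<^sub>L S t2"
    and "\<And>r::real. 0 \<le> r \<Longrightarrow>
      Sup ({ennreal (norm (F v - F w) / norm (v - w)) | v w. v \<noteq> w \<and> norm v + norm w \<le> r} \<union> {0})
      + (INF \<alpha>\<in>{0<..<1::real}. SUP (s, t)\<in>(SIGMA s:{0<..<T}. {s<..<T}).
           ennreal (s powr \<alpha> * (norm (S s) + norm (S t - S s) * inverse \<bar>\<phi> (t - s)\<bar>))) < \<infinity>"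
    and "Limsup (at_right 0) (\<lambda>t. ereal (\<phi> t)) = 0"
  shows "\<exists>!J. convex J \<and> J \<subseteq> {0..T} \<and> {0} \<subset> J
    \<and> (\<exists>!x. maximal_mild_solution T S F ob J x)
    \<and> (\<forall>x. maximal_mild_solution T S F ob J x \<longrightarrow>
          (\<forall>I y. convex I \<and> I \<subseteq> {0..T} \<and> J \<subseteq> I \<and> mild_solution S F ob I y \<longrightarrow> I = J \<and> x = y))
    \<and> (\<forall>y. mild_solution S F ob J y \<and> left_Limsup J (\<lambda>s. ennreal (norm (y s))) < \<infinity> \<longrightarrow> J = {0..T})"
proof -
  have lip: "\<exists>L. L-lipschitz_on (cball 0 r) F" for r
  proof (cases "0 \<le> r")
    case True
    \<comment> \<open>The hypothesis bounds the sum of two norms, hence the radius is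
      doubled.\<close>
    then show ?thesis
      using assms(9)[of "2 * r"] by (intro lipschitz_on_of_Sup_quotients) simp
  next
    case False
    then show ?thesis by (intro exI[of _ 0]) (simp add: lipschitz_on_def)
  qed
  let ?q = "\<lambda>\<alpha> s t. s powr \<alpha> * (norm (S s) + norm (S t - S s) * inverse \<bar>\<phi> (t - s)\<bar>)"
  \<comment> \<open>The kernel term does not depend on \<open>r\<close>, so any admissible radius,
    here 0, gives its finiteness.\<close>
  have "(INF \<alpha>\<in>{0<..<1::real}. SUP (s, t)\<in>(SIGMA s:{0<..<T}. {s<..<T}). ennreal (?q \<alpha> s t)) < \<infinity>"
    using assms(9)[of 0] by simp
  then obtain \<alpha> where \<alpha>: "0 < \<alpha>" "\<alpha> < 1"
    and fin: "(SUP (s, t)\<in>(SIGMA s:{0<..<T}. {s<..<T}). ennreal (?q \<alpha> s t)) < \<infinity>" (is "?C < _")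
    unfolding INF_less_iff by auto
  define C where "C = enn2real ?C"
  have C0: "0 \<le> C" by (simp add: C_def)
  have q: "?q \<alpha> s t \<le> C" if "0 < s" "s < t" "t < T" for s t
  proof -
    have "ennreal (?q \<alpha> s t) \<le> ?C"
      using that by (intro SUP_upper2[of "(s, t)"]) auto
    then show ?thesis
      unfolding C_def using fin by (rule le_enn2real)
  qed
  have div: "a \<le> C * s powr - \<alpha>" if "s powr \<alpha> * a \<le> C" "0 < s" for a s
    using that by (simp add: powr_minus field_simps)
  have bound: "norm (S s) \<le> C * s powr - \<alpha>" if s: "s \<in> {0<..<T}" for s
  proof (rule div)
    \<comment> \<open>The supremum runs over pairs, so bounding \<open>S s\<close> alone requires
      some partner \<open>t\<close> between \<open>s\<close> and \<open>T\<close>.\<close>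
    obtain t where t: "s < t" "t < T" using s dense[of s T] by auto
    have "s powr \<alpha> * norm (S s) \<le> ?q \<alpha> s t" by (intro mult_left_mono) auto
    also have "\<dots> \<le> C" using s t by (intro q) auto
    finally show "s powr \<alpha> * norm (S s) \<le> C" .
  qed (use s in auto)
  have diff: "norm (S t - S s) \<le> C * s powr - \<alpha> * \<phi> (t - s)" if st: "0 < s" "s < t" "t < T" for s t
  proof -
    have pos: "0 < \<phi> (t - s)" using st by (intro assms(6)) auto
    have "s powr \<alpha> * (norm (S t - S s) * inverse \<bar>\<phi> (t - s)\<bar>) \<le> ?q \<alpha> s t"
      by (intro mult_left_mono) auto
    also have "\<dots> \<le> C" by (rule q[OF st])
    finally have "norm (S t - S s) * inverse \<bar>\<phi> (t - s)\<bar> \<le> C * s powr - \<alpha>"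
      using st(1) by (rule div)
    then show ?thesis using pos by (simp add: field_simps)
  qed
  have lim: "(\<phi> \<longlongrightarrow> 0) (at_right 0)"
  proof (rule order_tendstoI)
    \<comment> \<open>The limit superior controls \<open>\<phi>\<close> only from above; the lower
      half of the limit comes from positivity.\<close>
    fix a :: real assume "a < 0"
    have "\<forall>\<^sub>F t in at_right 0. t \<in> {0<..<T}"
      using eventually_at_right_real[OF assms(1)] .
    then show "\<forall>\<^sub>F t in at_right 0. a < \<phi> t"
      by (rule eventually_mono) (rule less_trans[OF \<open>a < 0\<close> assms(6)])
  next
    fix a :: real assume "0 < a"
    then have "\<forall>\<^sub>F t in at_right 0. ereal (\<phi> t) < ereal a"
      by (intro Limsup_lessD) (simp add: assms(10))
    then show "\<forall>\<^sub>F t in at_right 0. \<phi> t < a" by simp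
  qed
  interpret mild_problem S C \<alpha> T F ob
    using assms(1-3,6) \<alpha> C0 bound lip continuous_on_of_modulus[OF diff C0 _ _ lim]
    by unfold_locales auto
  show ?thesis by (rule unique_maximal_interval)
qed

end
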